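(* Suppose $\alpha>1$. Then $$J_\alpha(\theta)=\cos\theta\,J_{\alpha-1}(\theta)+(\alpha-1)^2(2\alpha-1)^{-1}(2\alpha-3)^{-1}\sin^2\theta\,J_{\alpha-2}(\theta),$$ $$\mathbb J_\alpha(c)=c\,\mathbb J_{\alpha-1}(c)+(\alpha-1)^2(2\alpha-1)^{-1}(2\alpha-3)^{-1}(1-c^2)\,\mathbb J_{\alpha-2}(c).$$
   Context: Put $\mathsf c_\alpha=\frac1{\sqrt\pi}2^{\alpha-1}\Gamma(\alpha+\frac12)$. For $\alpha>-1$, the kernel functions of the $\alpha$-ReLU ($x\mapsto x^\alpha$ for $x>0$, $0$ otherwise) are $$J_\alpha(\theta)=\frac1{2\pi\mathsf c_\alpha}(\sin\theta)^{2\alpha+1}\,\Gamma(\alpha+1)\int_0^{\pi/2}\frac{\cos^\alpha\eta}{(1-\cos\theta\cos\eta)^{1+\alpha}}\,d\eta ,\qquad \mathbb J_\alpha(c)=J_\alpha(\arccos c).$$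
   Formalization: At α = 3/2, where (2α−3)^{-1} and c_{−1/2} are undefined, the last term is its limit in α; θ ranges over [0,π], with J at θ = 0, π extended by continuity and the sin²θ J_{α−2} term taken as 0 there. *)

theory Defs
  imports "HOL-Analysis.Analysis"
begin

text \<open>
  Kernel functions of the \<open>\<alpha>\<close>-ReLU, for \<open>\<alpha> > -1\<close>. At \<open>\<alpha> = -1/2\<close> the constant \<open>relu_c \<alpha>\<close>
  has its only pole in this range; HOL's conventions \<open>Gamma 0 = 0\<close> and \<open>1 / 0 = 0\<close> then give
  \<open>1 / relu_c (-1/2) = 0\<close>, which is the value of the entire function \<open>1 / relu_c\<close> there.
\<close>

definition relu_c :: "real \<Rightarrow> real" where
  "relu_c \<alpha> = 1 / sqrt pi * 2 powr (\<alpha> - 1) * Gamma (\<alpha> + 1/2)"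

definition J_formula :: "real \<Rightarrow> real \<Rightarrow> real" where
  "J_formula \<alpha> \<theta> =
     1 / (2 * pi * relu_c \<alpha>) * sin \<theta> powr (2 * \<alpha> + 1) * Gamma (\<alpha> + 1) *
     integral {0..pi/2} (\<lambda>\<eta>. cos \<eta> powr \<alpha> / (1 - cos \<theta> * cos \<eta>) powr (1 + \<alpha>))"

text \<open>
  The angle ranges over \<open>[0, \<pi>]\<close>. The formula makes sense on \<open>(0, \<pi>)\<close>; at \<open>\<theta> = 0\<close> it has the form
  \<open>0 \<cdot> \<infinity>\<close> if \<open>\<alpha> > -1/2\<close>, and evaluating it with HOL's totalised operations would give \<open>0\<close> instead
  of the intended value \<open>1\<close>. At both end points the kernel is therefore the continuous extension
  of the formula. That extension exists if \<open>\<alpha> \<ge> -1/2\<close>. For \<open>\<alpha> < -1/2\<close> the kernel is unbounded near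
  the end points and its value there carries no meaning.
\<close>

definition relu_J :: "real \<Rightarrow> real \<Rightarrow> real" where
  "relu_J \<alpha> \<theta> =
     (if \<theta> \<in> {0<..<pi} then J_formula \<alpha> \<theta>
      else Lim (at \<theta> within {0<..<pi}) (J_formula \<alpha>))"

definition relu_JJ :: "real \<Rightarrow> real \<Rightarrow> real" where
  "relu_JJ \<alpha> c = relu_J \<alpha> (arccos c)"

end

theory Submission
  imports Defs
begin

text \<open>
  Differentiating \<open>sin \<eta> * cos \<eta> powr (\<alpha> - 1) / (1 - c * cos \<eta>) powr \<alpha>\<close>, which vanishes at both ends of
  \<open>[0, \<pi>/2]\<close> if \<open>\<alpha> > 1\<close>, gives a three-term recurrence for the integrals; multiplied by the prefactors
  it is the theorem on \<open>(0, \<pi>)\<close>. The summand with index \<open>\<alpha> - 2\<close> is first written with the constant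
  \<open>relu_c (\<alpha> - 1)\<close>, which removes the factor \<open>2 * \<alpha> - 3\<close> and leaves a function continuous in \<open>\<alpha>\<close>, also
  at \<open>\<alpha> = 3/2\<close>. At \<open>\<theta> = \<pi>\<close> all terms are \<open>0\<close>. At \<open>\<theta> = 0\<close> the recurrence shows that the difference of the
  two kernels tends to \<open>0\<close>, so their values there agree without being computed.
\<close>

section \<open>Integrability and bounds of the kernel integrals\<close>

text \<open>The integral factor of \<open>J_formula\<close>, with \<open>c\<close> in place of
  \<open>cos \<theta>\<close>.\<close>

definition kernel_integral :: "real \<Rightarrow> real \<Rightarrow> real" where
  "kernel_integral \<beta> c =
     integral {0..pi/2} (\<lambda>\<eta>. cos \<eta> powr \<beta> / (1 - c * cos \<eta>) powr (1 + \<beta>))"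

text \<open>Concavity of \<open>sin\<close>, read from the other end of the interval. The linear
  bound controls negative powers of \<open>cos\<close> near their singularity at
  \<open>pi/2\<close>.\<close>

lemma cos_ge_chord:
  fixes x :: real
  assumes "0 \<le> x" "x \<le> pi/2"
  shows "2 / pi * (pi/2 - x) \<le> cos x"
proof -
  have "concave_on {0..pi/2} sin"
    by (rule f''_le0_imp_concave[where f' = cos and f'' = "\<lambda>x. - sin x"])
      (auto intro!: derivative_eq_intros sin_ge_zero)
  from concave_onD_Icc'[OF this, of "pi/2 - x"] show ?thesis
    using assms by (simp add: sin_diff)
qed

lemma cos_powr_integrable:
  fixes \<beta> :: real
  assumes "\<beta> > -1"
  shows "(\<lambda>x. cos x powr \<beta>) integrable_on {0..pi/2}"
proof (rule measurable_bounded_by_integrable_imp_integrable)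
  \<comment> \<open>The power of the chord dominates if \<beta> < 0 and \<open>x < pi/2\<close>. The
    summand \<open>1\<close> covers \<beta> \<ge> 0 and the point \<open>pi/2\<close>, where
    \<open>0 powr \<beta> = 0\<close>.\<close>
  define g where "g x = 1 + (2 / pi * (pi/2 - x)) powr \<beta>" for x
  \<comment> \<open>Reflection and a shift move the integrable singularity of
    \<open>x powr \<beta>\<close> from \<open>0\<close> to \<open>pi/2\<close>.\<close>
  have "(\<lambda>x. (- x) powr \<beta>) integrable_on {-(pi/2)..-0}"
    using integrable_on_powr_from_0[OF assms, of "pi/2"]
      Henstock_Kurzweil_Integration.integrable_reflect_real[where f = "\<lambda>x. x powr \<beta>" and a = 0 and b = "pi/2"]
    by simp
  from integrable_shift_real_ivl[OF this, of "-(pi/2)"]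
  have "(\<lambda>x. (pi/2 - x) powr \<beta>) integrable_on {0..pi/2}" by simp
  then have "(\<lambda>x. 1 + (2 / pi) powr \<beta> * (pi/2 - x) powr \<beta>) integrable_on {0..pi/2}"
    by (intro integrable_add integrable_on_cmult_left) auto
  then show "g integrable_on {0..pi/2}"
    by (rule integrable_eq) (unfold g_def, subst powr_mult, auto)
  show "(\<lambda>x. cos x powr \<beta>) \<in> borel_measurable (lebesgue_on {0..pi/2})"
    by (rule borel_measurable_if_D, rule measurable_completion) simp
  show "norm (cos x powr \<beta>) \<le> g x" if x: "x \<in> {0..pi/2}" for x
  proof (cases "\<beta> \<ge> 0 \<or> x = pi/2")
    case True
    have "cos x \<ge> 0" using x by (intro cos_ge_zero) auto
    then have "cos x powr \<beta> \<le> 1" using True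
    proof (elim disjE)
      assume "x = pi/2"
      then show ?thesis by (simp only: cos_pi_half) simp
    qed (auto intro: powr_le1)
    then show ?thesis by (simp add: g_def add_increasing2)
  next
    case False
    then have "cos x powr \<beta> \<le> (2 / pi * (pi/2 - x)) powr \<beta>"
      using x cos_ge_chord[of x] by (intro powr_mono2') auto
    then show ?thesis by (simp add: g_def)
  qed
qed auto

text \<open>The right-hand side is affine in \<open>cos x\<close>, which lies in
  \<open>[0, 1]\<close>, and takes the values \<open>1\<close> and \<open>1 - c\<close> at the ends
  of that range.\<close>

lemma one_minus_mult_cos_ge:
  fixes c x :: real
  assumes "\<bar>c\<bar> < 1" "0 \<le> x" "x \<le> pi/2"
  shows "min 1 (1 - c) \<le> 1 - c * cos x"
proof (cases "c \<ge> 0")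
  case True
  then have "c * cos x \<le> c * 1" by (intro mult_left_mono) auto
  then show ?thesis by auto
next
  case False
  have "cos x \<ge> 0" using assms by (intro cos_ge_zero) auto
  then have "c * cos x \<le> 0" using False by (intro mult_nonpos_nonneg) auto
  then show ?thesis by auto
qed

lemma kernel_integrand_bounds:
  fixes \<beta> c x :: real
  assumes "\<beta> > -1" "\<bar>c\<bar> < 1" "0 \<le> x" "x \<le> pi/2"
  shows "0 \<le> cos x powr \<beta> / (1 - c * cos x) powr (1 + \<beta>)"
    and "cos x powr \<beta> / (1 - c * cos x) powr (1 + \<beta>)
           \<le> cos x powr \<beta> / min 1 (1 - c) powr (1 + \<beta>)"
proof -
  have m: "0 < min 1 (1 - c)" using assms by auto
  have "min 1 (1 - c) powr (1 + \<beta>) \<le> (1 - c * cos x) powr (1 + \<beta>)"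
    using one_minus_mult_cos_ge[OF assms(2-4)] assms(1) m by (intro powr_mono2) auto
  then show "cos x powr \<beta> / (1 - c * cos x) powr (1 + \<beta>)
           \<le> cos x powr \<beta> / min 1 (1 - c) powr (1 + \<beta>)"
    using m one_minus_mult_cos_ge[OF assms(2-4)] by (intro divide_left_mono mult_pos_pos) auto
qed simp

lemma kernel_integrand_integrable:
  fixes \<beta> c :: real
  assumes "\<beta> > -1" "\<bar>c\<bar> < 1"
  shows "(\<lambda>x. cos x powr \<beta> / (1 - c * cos x) powr (1 + \<beta>)) integrable_on {0..pi/2}"
proof (rule measurable_bounded_by_integrable_imp_integrable)
  show "(\<lambda>x. cos x powr \<beta> / (1 - c * cos x) powr (1 + \<beta>)) \<in> borel_measurable (lebesgue_on {0..pi/2})"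
    by (rule borel_measurable_if_D, rule measurable_completion) simp
  show "(\<lambda>x. cos x powr \<beta> / min 1 (1 - c) powr (1 + \<beta>)) integrable_on {0..pi/2}"
    using integrable_on_divide[OF cos_powr_integrable[OF assms(1)]] .
  show "norm (cos x powr \<beta> / (1 - c * cos x) powr (1 + \<beta>)) \<le> cos x powr \<beta> / min 1 (1 - c) powr (1 + \<beta>)"
    if "x \<in> {0..pi/2}" for x
    using kernel_integrand_bounds[OF assms, of x] that by auto
qed auto

text \<open>The explicit dependence on \<open>c\<close> serves the end-point limits: the divisor is
  \<open>1\<close> for \<open>c \<le> 0\<close>, and a power of \<open>1 - c\<close> as
  \<open>c\<close> approaches \<open>1\<close>.\<close>

lemma kernel_integral_bounds:
  fixes \<beta> c :: real
  assumes "\<beta> > -1" "\<bar>c\<bar> < 1"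
  shows "0 \<le> kernel_integral \<beta> c"
    and "kernel_integral \<beta> c \<le> integral {0..pi/2} (\<lambda>x. cos x powr \<beta>) / min 1 (1 - c) powr (1 + \<beta>)"
proof -
  note b = kernel_integrand_bounds[OF assms] and i = kernel_integrand_integrable[OF assms]
  show "0 \<le> kernel_integral \<beta> c"
    unfolding kernel_integral_def by (intro integral_nonneg i) simp
  have "kernel_integral \<beta> c \<le> integral {0..pi/2} (\<lambda>x. cos x powr \<beta> / min 1 (1 - c) powr (1 + \<beta>))"
    unfolding kernel_integral_def
    using b(2) by (intro integral_le i integrable_on_divide cos_powr_integrable assms) auto
  then show "kernel_integral \<beta> c \<le> integral {0..pi/2} (\<lambda>x. cos x powr \<beta>) / min 1 (1 - c) powr (1 + \<beta>)"
    by simp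
qed

section \<open>The three-term recurrence of the integrals\<close>

lemma kernel_integral_recurrence:
  fixes \<alpha> c :: real
  assumes "\<alpha> > 1" "\<bar>c\<bar> < 1"
  shows "\<alpha> * (1 - c\<^sup>2) * kernel_integral \<alpha> c =
    (2 * \<alpha> - 1) * c * kernel_integral (\<alpha> - 1) c + (\<alpha> - 1) * kernel_integral (\<alpha> - 2) c"
proof -
  define f where "f \<beta> x = cos x powr \<beta> / (1 - c * cos x) powr (1 + \<beta>)" for \<beta> x
  define F where "F x = sin x * cos x powr (\<alpha> - 1) / (1 - c * cos x) powr \<alpha>" for x
  have D: "1 - c * cos x > 0" if "0 \<le> x" "x \<le> pi/2" for x
    using one_minus_mult_cos_ge[OF assms(2) that] assms(2) by auto
  have hi: "(f \<beta> has_integral kernel_integral \<beta> c) {0..pi/2}" if "\<beta> > -1" for \<beta>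
    using kernel_integrand_integrable[OF that assms(2)]
    unfolding f_def kernel_integral_def by (rule integrable_integral)
  let ?g = "\<lambda>x. \<alpha> * (1 - c\<^sup>2) * f \<alpha> x - (2 * \<alpha> - 1) * c * f (\<alpha> - 1) x - (\<alpha> - 1) * f (\<alpha> - 2) x"
  have "(?g has_integral (F (pi/2) - F 0)) {0..pi/2}"
  \<comment> \<open>For \<alpha> < 2 the derivative contains
    \<open>cos x powr (\<alpha> - 2)\<close> and is unbounded near \<open>pi/2\<close>, while
    \<open>F\<close> stays continuous there; hence the version with derivatives only in the
    interior.\<close>
  proof (rule fundamental_theorem_of_calculus_interior)
    show "continuous_on {0..pi/2} F"
      unfolding F_def using assms(1) D
      by (intro continuous_intros continuous_on_powr') (force simp: cos_ge_zero)+
    show "(F has_vector_derivative ?g x) (at x)" if x: "x \<in> {0<..<pi/2}" for x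
    proof -
      define u where "u = cos x"
      define d where "d = 1 - c * u"
      have u: "u > 0" unfolding u_def using x by (intro cos_gt_zero) auto
      have d: "d > 0" unfolding d_def u_def using D[of x] x by auto
      have s: "sin x ^ 2 = 1 - u\<^sup>2" by (simp add: u_def sin_squared_eq)
      \<comment> \<open>With the lowest power of \<open>u\<close> and the quotient's power of
        \<open>d\<close> split off, the three integrands are \<open>P / Q\<close> times
        \<open>(u / d)^2\<close>, \<open>u / d\<close> and \<open>1\<close>, and what remains is
        polynomial algebra.\<close>
      define P where "P = u powr (\<alpha> - 2)"
      define Q where "Q = d powr (\<alpha> - 1)"
      have pw: "u powr \<alpha> = P * u\<^sup>2" "u powr (\<alpha> - 1) = P * u" "u powr (\<alpha> - 2) = P"
        using u by (simp_all add: P_def powr_diff power2_eq_square field_simps)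
      have qw: "d powr (1 + \<alpha>) = Q * d\<^sup>2" "d powr \<alpha> = Q * d" "d powr (\<alpha> - 1) = Q" "Q > 0"
        using d by (simp_all add: Q_def powr_diff powr_add power2_eq_square field_simps)
      have "(F has_real_derivative ((u * u powr (\<alpha> - 1) + sin x * ((\<alpha> - 1) * u powr (\<alpha> - 1 - 1) * (- sin x))) * d powr \<alpha>
           - (sin x * u powr (\<alpha> - 1)) * (\<alpha> * d powr (\<alpha> - 1) * (c * sin x))) / (d powr \<alpha>)\<^sup>2) (at x)"
        unfolding F_def
      proof (rule DERIV_cong)
        have du: "((\<lambda>x. cos x powr (\<alpha> - 1)) has_real_derivative (\<alpha> - 1) * u powr (\<alpha> - 1 - 1) * (- sin x)) (at x)"
          unfolding u_def
          by (rule DERIV_chain2[OF has_real_derivative_powr[OF u[unfolded u_def]] DERIV_cos])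
        have "((\<lambda>x. 1 - c * cos x) has_real_derivative 0 - c * (- sin x)) (at x)"
          by (intro DERIV_diff DERIV_const DERIV_cmult DERIV_cos)
        from DERIV_chain2[OF has_real_derivative_powr[OF d[unfolded d_def u_def]] this]
        have dd: "((\<lambda>x. (1 - c * cos x) powr \<alpha>) has_real_derivative
            \<alpha> * d powr (\<alpha> - 1) * (0 - c * (- sin x))) (at x)"
          unfolding d_def u_def .
        have "(1 - c * cos x) powr \<alpha> \<noteq> 0" using d by (simp add: d_def u_def)
        from DERIV_divide[OF DERIV_mult[OF DERIV_sin du] dd this]
        show "((\<lambda>x. sin x * cos x powr (\<alpha> - 1) / (1 - c * cos x) powr \<alpha>) has_real_derivative
            ((cos x * cos x powr (\<alpha> - 1) + (\<alpha> - 1) * u powr (\<alpha> - 1 - 1) * (- sin x) * sin x) * (1 - c * cos x) powr \<alpha>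
             - sin x * cos x powr (\<alpha> - 1) * (\<alpha> * d powr (\<alpha> - 1) * (0 - c * (- sin x))))
             / ((1 - c * cos x) powr \<alpha> * (1 - c * cos x) powr \<alpha>)) (at x)" .
      qed (simp add: u_def d_def power2_eq_square mult_ac)
      also have "((u * u powr (\<alpha> - 1) + sin x * ((\<alpha> - 1) * u powr (\<alpha> - 1 - 1) * (- sin x))) * d powr \<alpha>
           - (sin x * u powr (\<alpha> - 1)) * (\<alpha> * d powr (\<alpha> - 1) * (c * sin x))) / (d powr \<alpha>)\<^sup>2
         = ((u * (P * u) - (\<alpha> - 1) * P * (sin x)\<^sup>2) * (Q * d)
           - P * u * \<alpha> * Q * c * (sin x)\<^sup>2) / (Q * d)\<^sup>2"
        by (simp add: pw qw power2_eq_square algebra_simps)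
      also have "\<dots> = Q * (P * ((u\<^sup>2 - (\<alpha> - 1) * (1 - u\<^sup>2)) * d - \<alpha> * c * u * (1 - u\<^sup>2))) / (Q * (Q * d\<^sup>2))"
        unfolding s by (simp add: power2_eq_square algebra_simps)
      also have "\<dots> = P * ((u\<^sup>2 - (\<alpha> - 1) * (1 - u\<^sup>2)) * d - \<alpha> * c * u * (1 - u\<^sup>2)) / (Q * d\<^sup>2)"
        using qw(4) by simp
      \<comment> \<open>Substituting \<open>d = 1 - c * u\<close> turns the numerator into a
        combination of \<open>u^2\<close>, \<open>u * d\<close> and \<open>d^2\<close>, one monomial
        for each integral; its coefficients are those of the recurrence.\<close>
      also have "(u\<^sup>2 - (\<alpha> - 1) * (1 - u\<^sup>2)) * d - \<alpha> * c * u * (1 - u\<^sup>2)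
          = \<alpha> * (1 - c\<^sup>2) * u\<^sup>2 - (2 * \<alpha> - 1) * c * (u * d) - (\<alpha> - 1) * d\<^sup>2"
        by (simp add: d_def power2_eq_square algebra_simps)
      also have "P * \<dots> / (Q * d\<^sup>2) = \<alpha> * (1 - c\<^sup>2) * (P * u\<^sup>2 / (Q * d\<^sup>2))
          - (2 * \<alpha> - 1) * c * (P * u * d / (Q * d\<^sup>2)) - (\<alpha> - 1) * (P * d\<^sup>2 / (Q * d\<^sup>2))"
        by (simp add: right_diff_distrib diff_divide_distrib mult_ac)
      also have "\<dots> = \<alpha> * (1 - c\<^sup>2) * (P * u\<^sup>2 / (Q * d\<^sup>2))
          - (2 * \<alpha> - 1) * c * (P * u / (Q * d)) - (\<alpha> - 1) * (P / Q)"
      proof -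
        have "P * u * d / (Q * d\<^sup>2) = P * u / (Q * d)" "P * d\<^sup>2 / (Q * d\<^sup>2) = P / Q"
          using d by (simp_all add: power2_eq_square)
        then show ?thesis by (simp only:)
      qed
      also have "\<dots> = ?g x"
        unfolding f_def u_def[symmetric] d_def[symmetric] by (simp add: pw qw)
      finally show ?thesis by (simp add: has_real_derivative_iff_has_vector_derivative)
    qed
  qed simp
  then have "(?g has_integral 0) {0..pi/2}" by (simp add: F_def)
  moreover have "(?g has_integral (\<alpha> * (1 - c\<^sup>2) * kernel_integral \<alpha> c
      - (2 * \<alpha> - 1) * c * kernel_integral (\<alpha> - 1) c - (\<alpha> - 1) * kernel_integral (\<alpha> - 2) c)) {0..pi/2}"
    using assms(1) by (intro has_integral_diff has_integral_mult_right hi) auto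
  ultimately have "0 = \<alpha> * (1 - c\<^sup>2) * kernel_integral \<alpha> c
      - (2 * \<alpha> - 1) * c * kernel_integral (\<alpha> - 1) c - (\<alpha> - 1) * kernel_integral (\<alpha> - 2) c"
    by (rule has_integral_unique)
  then show ?thesis by simp
qed

section \<open>Prefactors and continuity in the index\<close>

lemma J_formula_kernel_integral:
  "J_formula \<beta> \<theta> =
     Gamma (\<beta> + 1) / (2 * pi * relu_c \<beta>) * sin \<theta> powr (2 * \<beta> + 1) * kernel_integral \<beta> (cos \<theta>)"
  unfolding J_formula_def kernel_integral_def by simp

text \<open>The functional equation of \<open>Gamma\<close>. At \<beta> = -1/2 it would fail: the
  left side is positive and the factor \<open>2 * \<beta> + 1\<close> is \<open>0\<close>.\<close>

lemma relu_c_plus1: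
  assumes "\<beta> \<noteq> -1/2"
  shows "relu_c (\<beta> + 1) = (2 * \<beta> + 1) * relu_c \<beta>"
proof -
  \<comment> \<open>The functional equation of the entire function \<open>rGamma\<close> holds at
    every argument; inverting it requires only that \<beta> + 1/2 is nonzero.\<close>
  have "Gamma (\<beta> + 1/2 + 1) = (\<beta> + 1/2) * Gamma (\<beta> + 1/2)"
  proof -
    have "\<beta> + 1/2 \<noteq> 0" using assms by auto
    moreover have "rGamma (\<beta> + 1/2) = (\<beta> + 1/2) * rGamma (\<beta> + 1/2 + 1)"
      by (rule rGamma_plus1[symmetric])
    ultimately show ?thesis by (simp only: Gamma_def inverse_mult_distrib) simp
  qed
  then show ?thesis
    by (simp add: relu_c_def powr_diff powr_add field_simps)
qed

lemma relu_c_pos: "\<beta> > -1/2 \<Longrightarrow> relu_c \<beta> > 0"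
  unfolding relu_c_def by (intro mult_pos_pos Gamma_real_pos) auto

text \<open>For \<beta> > 0 the integrand is jointly continuous up to \<open>x = pi/2\<close>, so
  continuity passes under the integral sign over a compact interval.\<close>

lemma isCont_kernel_integral:
  fixes \<beta> c :: real
  assumes "\<beta> > 0" "\<bar>c\<bar> < 1"
  shows "isCont (\<lambda>\<beta>. kernel_integral \<beta> c) \<beta>"
proof -
  have "continuous_on {0<..} (\<lambda>\<beta>. integral (cbox 0 (pi/2)) (\<lambda>x. cos x powr \<beta> / (1 - c * cos x) powr (1 + \<beta>)))"
  proof (rule integral_continuous_on_param)
    have D: "1 - c * cos x > 0" if "0 \<le> x" "x \<le> pi/2" for x
      using one_minus_mult_cos_ge[OF assms(2) that] assms(2) by auto
    show "continuous_on ({0<..} \<times> cbox 0 (pi/2)) (\<lambda>(\<beta>, x). cos x powr \<beta> / (1 - c * cos x) powr (1 + \<beta>))"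
      unfolding case_prod_beta using D
      by (intro continuous_intros continuous_on_powr') (force simp: cos_ge_zero)+
  qed
  then show ?thesis
    using assms(1) by (simp add: kernel_integral_def continuous_on_eq_continuous_at)
qed

lemma abs_cos_less_1:
  fixes \<theta> :: real
  assumes "\<theta> \<in> {0<..<pi}"
  shows "\<bar>cos \<theta>\<bar> < 1"
proof -
  have "sin \<theta> > 0" using assms by (auto intro: sin_gt_zero)
  then show ?thesis using sin_cos_squared_add[of \<theta>]
    by (metis abs_square_less_1 less_add_same_cancel2 zero_less_power)
qed

lemma isCont_J_formula:
  fixes \<beta> \<theta> :: real
  assumes "\<beta> > 0" "\<theta> \<in> {0<..<pi}"
  shows "isCont (\<lambda>\<beta>. J_formula \<beta> \<theta>) \<beta>"
proof -
  have s: "sin \<theta> > 0" using assms(2) by (auto intro: sin_gt_zero)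
  have c: "\<bar>cos \<theta>\<bar> < 1" by (rule abs_cos_less_1[OF assms(2)])
  have "\<beta> + 1/2 \<notin> \<int>\<^sub>\<le>\<^sub>0" "\<beta> + 1 \<notin> \<int>\<^sub>\<le>\<^sub>0" using assms by (auto elim!: nonpos_Ints_cases)
  then have G: "isCont (\<lambda>\<beta>. Gamma (\<beta> + 1/2)) \<beta>" "isCont (\<lambda>\<beta>. Gamma (\<beta> + 1)) \<beta>"
    by (auto intro!: isCont_Gamma continuous_intros)
  have "isCont (\<lambda>\<beta>. 2 powr (\<beta> - 1)) \<beta>" "isCont (\<lambda>\<beta>. sin \<theta> powr (2 * \<beta> + 1)) \<beta>"
    using s unfolding isCont_def by (intro tendsto_powr tendsto_intros; simp)+
  moreover from this(1) have "isCont relu_c \<beta>"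
    unfolding relu_c_def[abs_def] by (intro isCont_mult continuous_const G(1))
  moreover have "relu_c \<beta> \<noteq> 0" using relu_c_pos[of \<beta>] assms(1) by simp
  ultimately show ?thesis
    unfolding J_formula_kernel_integral
    by (intro isCont_mult isCont_divide continuous_const G(2) isCont_kernel_integral[OF assms(1) c]) auto
qed

section \<open>The recurrence on the open interval\<close>

text \<open>The summand with index \<open>\<alpha> - 2\<close> after cancellation: as \<alpha> tends
  to 3/2, both \<open>1 / relu_c (\<alpha> - 2)\<close> and \<open>2 * \<alpha> - 3\<close> tend to
  \<open>0\<close>, but their quotient is \<open>1 / relu_c (\<alpha> - 1)\<close>.\<close>

definition J_remainder :: "real \<Rightarrow> real \<Rightarrow> real" where
  "J_remainder \<alpha> \<theta> = (\<alpha> - 1) * Gamma \<alpha> / ((2 * \<alpha> - 1) * (2 * pi * relu_c (\<alpha> - 1)))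
     * sin \<theta> powr (2 * \<alpha> - 1) * kernel_integral (\<alpha> - 2) (cos \<theta>)"

lemma powr_eq_powr_mult_square:
  fixes x :: real
  assumes "x > 0" "b = a + 2"
  shows "x powr b = x powr a * x\<^sup>2"
  using assms by (simp add: powr_add)

lemma J_formula_recurrence:
  fixes \<alpha> \<theta> :: real
  assumes "\<alpha> > 1" "\<theta> \<in> {0<..<pi}"
  shows "J_formula \<alpha> \<theta> = cos \<theta> * J_formula (\<alpha> - 1) \<theta> + J_remainder \<alpha> \<theta>"
proof -
  have s: "sin \<theta> > 0" using assms(2) by (auto intro: sin_gt_zero)
  \<comment> \<open>The factor that turns the left side of the integral recurrence into
    \<open>J_formula \<alpha> \<theta>\<close>: \<alpha> comes from \<open>Gamma\<close>,
    \<open>2 * \<alpha> - 1\<close> from \<open>relu_c\<close>, and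
    \<open>1 - (cos \<theta>)^2\<close> from two powers of the sine.\<close>
  define K where "K = Gamma \<alpha> / ((2 * \<alpha> - 1) * (2 * pi * relu_c (\<alpha> - 1))) * sin \<theta> powr (2 * \<alpha> - 1)"
  have c: "relu_c \<alpha> = (2 * \<alpha> - 1) * relu_c (\<alpha> - 1)"
    using relu_c_plus1[of "\<alpha> - 1"] assms(1) by (simp add: algebra_simps)
  have G: "Gamma (\<alpha> + 1) = \<alpha> * Gamma \<alpha>"
    using assms(1) by (intro Gamma_plus1) (auto elim!: nonpos_Ints_cases)
  have p: "sin \<theta> powr (2 * \<alpha> + 1) = sin \<theta> powr (2 * \<alpha> - 1) * (1 - (cos \<theta>)\<^sup>2)"
    using powr_eq_powr_mult_square[OF s, of "2 * \<alpha> + 1" "2 * \<alpha> - 1"] by (simp add: sin_squared_eq)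
  have "J_formula \<alpha> \<theta> = K * (\<alpha> * (1 - (cos \<theta>)\<^sup>2) * kernel_integral \<alpha> (cos \<theta>))"
    unfolding J_formula_kernel_integral G c p K_def by (simp add: mult_ac)
  also have "\<dots> = K * ((2 * \<alpha> - 1) * cos \<theta> * kernel_integral (\<alpha> - 1) (cos \<theta>))
      + K * ((\<alpha> - 1) * kernel_integral (\<alpha> - 2) (cos \<theta>))"
    unfolding kernel_integral_recurrence[OF assms(1) abs_cos_less_1[OF assms(2)]]
    by (rule distrib_left)
  also have "K * ((2 * \<alpha> - 1) * cos \<theta> * kernel_integral (\<alpha> - 1) (cos \<theta>)) = cos \<theta> * J_formula (\<alpha> - 1) \<theta>"
    using assms(1) by (simp add: J_formula_kernel_integral K_def mult_ac)
  also have "K * ((\<alpha> - 1) * kernel_integral (\<alpha> - 2) (cos \<theta>)) = J_remainder \<alpha> \<theta>"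
    by (simp add: K_def J_remainder_def)
  finally show ?thesis .
qed

text \<open>\<open>\<alpha> = 3/2\<close> is excluded because there \<open>relu_c (\<alpha> - 2)\<close> has its pole, so that the right-hand side is \<open>0\<close>.\<close>

lemma J_remainder_eq:
  fixes \<alpha> \<theta> :: real
  assumes "\<alpha> > 1" "\<alpha> \<noteq> 3/2" "\<theta> \<in> {0<..<pi}"
  shows "J_remainder \<alpha> \<theta> =
    (\<alpha> - 1)\<^sup>2 * inverse (2 * \<alpha> - 1) * inverse (2 * \<alpha> - 3) * (sin \<theta>)\<^sup>2 * J_formula (\<alpha> - 2) \<theta>"
proof -
  have s: "sin \<theta> > 0" using assms(3) by (auto intro: sin_gt_zero)
  have c: "relu_c (\<alpha> - 1) = (2 * \<alpha> - 3) * relu_c (\<alpha> - 2)"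
    using relu_c_plus1[of "\<alpha> - 2"] assms(2) by (simp add: algebra_simps)
  have G: "Gamma \<alpha> = (\<alpha> - 1) * Gamma (\<alpha> - 1)"
  proof -
    have "\<alpha> - 1 \<notin> \<int>\<^sub>\<le>\<^sub>0" using assms(1) by (auto elim!: nonpos_Ints_cases)
    from Gamma_plus1[OF this] show ?thesis by simp
  qed
  have p: "sin \<theta> powr (2 * \<alpha> - 1) = sin \<theta> powr (2 * (\<alpha> - 2) + 1) * (sin \<theta>)\<^sup>2"
    using s by (rule powr_eq_powr_mult_square) simp
  show ?thesis
    unfolding J_remainder_def J_formula_kernel_integral c G p
    by (simp add: power2_eq_square divide_simps)
qed

section \<open>Behaviour at the end points\<close>

text \<open>Since \<open>1 - cos \<theta>\<close> is at least half the square of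
  \<open>sin \<theta>\<close>, the integral grows at most like
  \<open>sin \<theta> powr - (2 * \<beta> + 2)\<close>. The exponent \<open>2 * \<beta> + 3\<close>
  leaves one factor \<open>sin \<theta>\<close>, which forces the limit \<open>0\<close>.\<close>

lemma sin_powr_mult_kernel_integral_le:
  fixes \<beta> \<theta> :: real
  assumes "\<beta> > -1" "\<theta> \<in> {0<..<pi}"
  shows "sin \<theta> powr (2 * \<beta> + 3) * kernel_integral \<beta> (cos \<theta>)
    \<le> integral {0..pi/2} (\<lambda>x. cos x powr \<beta>) * 2 powr (1 + \<beta>) * sin \<theta>"
proof -
  define C where "C = integral {0..pi/2} (\<lambda>x. cos x powr \<beta>)"
  have C: "C \<ge> 0" unfolding C_def by (intro integral_nonneg cos_powr_integrable assms) simp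
  have s: "sin \<theta> > 0" using assms(2) by (auto intro: sin_gt_zero)
  note c = abs_cos_less_1[OF assms(2)]
  have "(sin \<theta>)\<^sup>2 = (1 - cos \<theta>) * (1 + cos \<theta>)"
    by (simp add: sin_squared_eq power2_eq_square algebra_simps)
  also have "\<dots> \<le> (1 - cos \<theta>) * 2" using c by (intro mult_left_mono) auto
  finally have "(sin \<theta>)\<^sup>2 / 2 \<le> 1 - cos \<theta>" by simp
  moreover have "(sin \<theta>)\<^sup>2 / 2 \<le> 1" 
    using sin_cos_squared_add[of \<theta>] zero_le_power2[of "cos \<theta>"] by linarith
  ultimately have "(sin \<theta>)\<^sup>2 / 2 \<le> min 1 (1 - cos \<theta>)" by simp
  then have m: "((sin \<theta>)\<^sup>2 / 2) powr (1 + \<beta>) \<le> min 1 (1 - cos \<theta>) powr (1 + \<beta>)"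
    using assms(1) by (intro powr_mono2) auto
  have "kernel_integral \<beta> (cos \<theta>) \<le> C / min 1 (1 - cos \<theta>) powr (1 + \<beta>)"
    unfolding C_def by (rule kernel_integral_bounds(2)[OF assms(1) c])
  also have "\<dots> \<le> C / ((sin \<theta>)\<^sup>2 / 2) powr (1 + \<beta>)"
    using m s C c by (intro divide_left_mono mult_pos_pos) auto
  also have "((sin \<theta>)\<^sup>2 / 2) powr (1 + \<beta>) = sin \<theta> powr (2 * \<beta> + 2) / 2 powr (1 + \<beta>)"
    using s by (simp add: powr_divide powr_powr flip: powr_numeral) (simp add: algebra_simps)
  finally have "sin \<theta> powr (2 * \<beta> + 3) * kernel_integral \<beta> (cos \<theta>)
      \<le> sin \<theta> powr (2 * \<beta> + 3) * (C / (sin \<theta> powr (2 * \<beta> + 2) / 2 powr (1 + \<beta>)))"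
    by (intro mult_left_mono) auto
  also have "\<dots> = C * 2 powr (1 + \<beta>) * sin \<theta>"
  proof -
    have "sin \<theta> powr (2 * \<beta> + 3) = sin \<theta> powr (2 * \<beta> + 2 + 1)" by (simp add: add_ac)
    also have "\<dots> = sin \<theta> powr (2 * \<beta> + 2) * sin \<theta>"
      unfolding powr_add[of _ _ 1] using s by simp
    finally show ?thesis using s by simp
  qed
  finally show ?thesis by (simp add: C_def)
qed

lemma sin_powr_mult_kernel_integral_tendsto_0:
  fixes \<beta> :: real
  assumes "\<beta> > -1"
  shows "((\<lambda>\<theta>. sin \<theta> powr (2 * \<beta> + 3) * kernel_integral \<beta> (cos \<theta>)) \<longlongrightarrow> 0) (at 0 within {0<..<pi})"
proof (rule tendsto_sandwich)
  show "\<forall>\<^sub>F \<theta> in at 0 within {0<..<pi}. 0 \<le> sin \<theta> powr (2 * \<beta> + 3) * kernel_integral \<beta> (cos \<theta>)"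
    using kernel_integral_bounds(1)[OF assms abs_cos_less_1]
    by (auto simp: eventually_at_filter)
  show "\<forall>\<^sub>F \<theta> in at 0 within {0<..<pi}. sin \<theta> powr (2 * \<beta> + 3) * kernel_integral \<beta> (cos \<theta>)
      \<le> integral {0..pi/2} (\<lambda>x. cos x powr \<beta>) * 2 powr (1 + \<beta>) * sin \<theta>"
    using sin_powr_mult_kernel_integral_le[OF assms] by (simp add: eventually_at_filter)
  have "((\<lambda>\<theta>. integral {0..pi/2} (\<lambda>x. cos x powr \<beta>) * 2 powr (1 + \<beta>) * sin \<theta>) \<longlongrightarrow>
      integral {0..pi/2} (\<lambda>x. cos x powr \<beta>) * 2 powr (1 + \<beta>) * sin 0) (at 0 within {0<..<pi})"
    by (intro tendsto_intros)
  then show "((\<lambda>\<theta>. integral {0..pi/2} (\<lambda>x. cos x powr \<beta>) * 2 powr (1 + \<beta>) * sin \<theta>) \<longlongrightarrow> 0)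
      (at 0 within {0<..<pi})" by simp
qed simp

lemma J_formula_tendsto_at_pi:
  fixes \<beta> :: real
  assumes "\<beta> > -1/2"
  shows "(J_formula \<beta> \<longlongrightarrow> 0) (at pi within {0<..<pi})"
proof -
  define C where "C = integral {0..pi/2} (\<lambda>x. cos x powr \<beta>)"
  have b: "\<beta> > -1" using assms by simp
  have "((\<lambda>\<theta>. sin \<theta> powr (2 * \<beta> + 1) * kernel_integral \<beta> (cos \<theta>)) \<longlongrightarrow> 0) (at pi within {0<..<pi})"
  proof (rule tendsto_sandwich)
    show "\<forall>\<^sub>F \<theta> in at pi within {0<..<pi}. 0 \<le> sin \<theta> powr (2 * \<beta> + 1) * kernel_integral \<beta> (cos \<theta>)"
      using kernel_integral_bounds(1)[OF b abs_cos_less_1] by (auto simp: eventually_at_filter)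
    \<comment> \<open>Beyond \<open>pi/2\<close> the cosine is nonpositive, so the integral is
      bounded by the constant \<open>C\<close> and the positive power of the sine decides the
      limit.\<close>
    have "\<forall>\<^sub>F \<theta> in at pi within {0<..<pi}. \<theta> > pi/2"
      by (rule order_tendstoD[OF tendsto_ident_at]) simp
    moreover have "\<forall>\<^sub>F \<theta> in at pi within {0<..<pi}. \<theta> \<in> {0<..<pi}"
      by (simp add: eventually_at_filter)
    ultimately show "\<forall>\<^sub>F \<theta> in at pi within {0<..<pi}.
        sin \<theta> powr (2 * \<beta> + 1) * kernel_integral \<beta> (cos \<theta>) \<le> sin \<theta> powr (2 * \<beta> + 1) * C"
    proof eventually_elim
      case (elim \<theta>)
      have "cos \<theta> \<le> 0" using elim cos_monotone_0_pi_le[of "pi/2" \<theta>] by simp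
      then have "kernel_integral \<beta> (cos \<theta>) \<le> C"
        using kernel_integral_bounds(2)[OF b abs_cos_less_1[OF elim(2)]] by (simp add: C_def min_def)
      then show ?case by (intro mult_left_mono) auto
    qed
    have "((\<lambda>\<theta>. sin \<theta> powr (2 * \<beta> + 1)) \<longlongrightarrow> sin pi powr (2 * \<beta> + 1)) (at pi within {0<..<pi})"
      using assms by (intro tendsto_powr' tendsto_intros)
        (auto simp: eventually_at_filter intro!: always_eventually sin_ge_zero)
    from tendsto_mult_right[OF this, of C]
    show "((\<lambda>\<theta>. sin \<theta> powr (2 * \<beta> + 1) * C) \<longlongrightarrow> 0) (at pi within {0<..<pi})" by simp
  qed simp
  from tendsto_mult_left[OF this, of "Gamma (\<beta> + 1) / (2 * pi * relu_c \<beta>)"]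
  show ?thesis unfolding J_formula_kernel_integral[abs_def] by (simp add: mult.assoc)
qed

text \<open>By the recurrence the difference is \<open>J_remainder \<alpha> \<theta> - (1 - cos
  \<theta>) * J_formula (\<alpha> - 1) \<theta>\<close>. Writing \<open>1 - cos \<theta>\<close> as
  \<open>(sin \<theta>)^2 / (1 + cos \<theta>)\<close> raises the second sine exponent by two, so
  both terms have the form of the preceding limit, with \<beta> equal to \<open>\<alpha> - 2\<close>
  and \<open>\<alpha> - 1\<close>.\<close>

lemma J_formula_diff_tendsto_at_0:
  fixes \<alpha> :: real
  assumes "\<alpha> > 1"
  shows "((\<lambda>\<theta>. J_formula \<alpha> \<theta> - J_formula (\<alpha> - 1) \<theta>) \<longlongrightarrow> 0) (at 0 within {0<..<pi})"
proof -
  define K where "K = Gamma \<alpha> / (2 * pi * relu_c (\<alpha> - 1))"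
  let ?F = "at (0::real) within {0<..<pi}"
  let ?g = "\<lambda>\<beta> \<theta>. sin \<theta> powr (2 * \<beta> + 3) * kernel_integral \<beta> (cos \<theta>)"
  have "((\<lambda>\<theta>. (\<alpha> - 1) / (2 * \<alpha> - 1) * K * ?g (\<alpha> - 2) \<theta> - K / (1 + cos \<theta>) * ?g (\<alpha> - 1) \<theta>) \<longlongrightarrow>
      (\<alpha> - 1) / (2 * \<alpha> - 1) * K * 0 - K / (1 + cos 0) * 0) ?F"
    using assms by (intro tendsto_intros sin_powr_mult_kernel_integral_tendsto_0) auto
  moreover have "\<forall>\<^sub>F \<theta> in ?F. (\<alpha> - 1) / (2 * \<alpha> - 1) * K * ?g (\<alpha> - 2) \<theta> - K / (1 + cos \<theta>) * ?g (\<alpha> - 1) \<theta>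
      = J_formula \<alpha> \<theta> - J_formula (\<alpha> - 1) \<theta>"
  proof -
    have "(\<alpha> - 1) / (2 * \<alpha> - 1) * K * ?g (\<alpha> - 2) \<theta> - K / (1 + cos \<theta>) * ?g (\<alpha> - 1) \<theta>
      = J_formula \<alpha> \<theta> - J_formula (\<alpha> - 1) \<theta>" if t: "\<theta> \<in> {0<..<pi}" for \<theta>
    proof -
      have s: "sin \<theta> > 0" using t by (auto intro: sin_gt_zero)
      have c: "1 + cos \<theta> > 0" using abs_cos_less_1[OF t] by auto
      have "sin \<theta> powr (2 * (\<alpha> - 1) + 3) = sin \<theta> powr (2 * (\<alpha> - 1) + 1) * (sin \<theta>)\<^sup>2"
        using s by (rule powr_eq_powr_mult_square) simp
      also have "(sin \<theta>)\<^sup>2 = (1 - cos \<theta>) * (1 + cos \<theta>)"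
        by (simp add: sin_squared_eq power2_eq_square algebra_simps)
      finally have "K / (1 + cos \<theta>) * ?g (\<alpha> - 1) \<theta> = (1 - cos \<theta>) * J_formula (\<alpha> - 1) \<theta>"
        using c by (simp add: J_formula_kernel_integral K_def mult_ac)
      moreover have "(\<alpha> - 1) / (2 * \<alpha> - 1) * K * ?g (\<alpha> - 2) \<theta> = J_remainder \<alpha> \<theta>"
        by (simp add: J_remainder_def K_def)
      ultimately show ?thesis
        using J_formula_recurrence[OF assms t] by (simp add: algebra_simps)
    qed
    then show ?thesis by (simp add: eventually_at_filter)
  qed
  ultimately have "((\<lambda>\<theta>. J_formula \<alpha> \<theta> - J_formula (\<alpha> - 1) \<theta>) \<longlongrightarrow>
      (\<alpha> - 1) / (2 * \<alpha> - 1) * K * 0 - K / (1 + cos 0) * 0) ?F"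
    by (rule Lim_transform_eventually)
  then show ?thesis by simp
qed

section \<open>The recurrence on the closed interval\<close>

lemma relu_J_interior: "\<theta> \<in> {0<..<pi} \<Longrightarrow> relu_J \<beta> \<theta> = J_formula \<beta> \<theta>"
  by (simp add: relu_J_def)

lemma relu_J_at_pi:
  assumes "\<beta> > -1/2"
  shows "relu_J \<beta> pi = 0"
proof -
  \<comment> \<open>On a nontrivial filter limits are unique, so \<open>Lim\<close> returns the
    limit found above.\<close>
  have "at pi within {0<..<pi} \<noteq> bot"
    using at_within_Icc_at_left by (simp add: at_within_eq_bot_iff)
  then show ?thesis
    using tendsto_Lim[OF _ J_formula_tendsto_at_pi[OF assms]] by (simp add: relu_J_def)
qed

lemma relu_J_at_0:
  assumes "\<alpha> > 1"
  shows "relu_J \<alpha> 0 = relu_J (\<alpha> - 1) 0"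
proof -
  \<comment> \<open>\<open>Lim\<close> is a definite description, so two functions with the same set
    of limits have the same \<open>Lim\<close>.\<close>
  have "(J_formula \<alpha> \<longlongrightarrow> l) (at 0 within {0<..<pi}) \<longleftrightarrow> (J_formula (\<alpha> - 1) \<longlongrightarrow> l) (at 0 within {0<..<pi})" for l
    using Lim_transform_eq[OF J_formula_diff_tendsto_at_0[OF assms]] by simp
  then show ?thesis by (simp add: relu_J_def t2_space_class.Lim_def)
qed

lemma endpoint_cases:
  fixes \<theta> :: real
  assumes "\<theta> \<in> {0..pi}"
  obtains "\<theta> \<in> {0<..<pi}" | "\<theta> = 0" | "\<theta> = pi"
  using assms by fastforce

lemma relu_J_recurrence:
  assumes "\<alpha> > 1" "\<theta> \<in> {0..pi}"
  shows "relu_J \<alpha> \<theta> = cos \<theta> * relu_J (\<alpha> - 1) \<theta> + J_remainder \<alpha> \<theta>"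
  using assms(2)
proof (cases rule: endpoint_cases)
  case 1
  then show ?thesis using J_formula_recurrence[OF assms(1)] by (simp add: relu_J_interior)
next
  case 2
  \<comment> \<open>Here \<open>0 powr _ = 0\<close> removes the remainder and
    \<open>cos 0 = 1\<close>.\<close>
  then show ?thesis using relu_J_at_0[OF assms(1)] by (simp add: J_remainder_def)
next
  case 3
  then show ?thesis using assms(1) by (simp add: J_remainder_def relu_J_at_pi)
qed

text \<open>At the end points both sides vanish with \<open>sin \<theta>\<close>, whatever
  \<open>relu_J (\<alpha> - 2) \<theta>\<close> is; for \<alpha> < 3/2 that value carries no
  meaning.\<close>

lemma J_remainder_eq_relu_J:
  assumes "\<alpha> > 1" "\<alpha> \<noteq> 3/2" "\<theta> \<in> {0..pi}"
  shows "J_remainder \<alpha> \<theta> =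
    (\<alpha> - 1)\<^sup>2 * inverse (2 * \<alpha> - 1) * inverse (2 * \<alpha> - 3) * (sin \<theta>)\<^sup>2 * relu_J (\<alpha> - 2) \<theta>"
  using assms(3)
proof (cases rule: endpoint_cases)
  case 1
  then show ?thesis using J_remainder_eq[OF assms(1,2)] by (simp add: relu_J_interior)
qed (simp_all add: J_remainder_def)

section \<open>The limit in the index and the theorem\<close>

text \<open>In the interior the recurrence expresses the remainder through kernels of the positive
  indices \<beta> and \<open>\<beta> - 1\<close>, which are continuous in \<beta>. This avoids the
  unbounded integrand of index \<open>\<beta> - 2\<close>.\<close>

lemma isCont_J_remainder:
  assumes "\<alpha> > 1" "\<theta> \<in> {0..pi}"
  shows "isCont (\<lambda>\<beta>. J_remainder \<beta> \<theta>) \<alpha>"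
  using assms(2)
proof (cases rule: endpoint_cases)
  case 1
  have "isCont (\<lambda>\<beta>. J_formula \<beta> \<theta> - cos \<theta> * J_formula (\<beta> - 1) \<theta>) \<alpha>"
    using assms(1) 1
    by (intro continuous_intros isCont_J_formula
      isCont_o2[where f = "\<lambda>\<beta>. \<beta> - 1" and g = "\<lambda>\<beta>. J_formula \<beta> \<theta>"]) auto
  moreover have ev: "\<forall>\<^sub>F \<beta> in nhds \<alpha>. J_formula \<beta> \<theta> - cos \<theta> * J_formula (\<beta> - 1) \<theta> = J_remainder \<beta> \<theta>"
    using eventually_nhds_in_open[of "{1<..}" \<alpha>] assms(1)
    by (auto elim!: eventually_mono simp: J_formula_recurrence[OF _ 1])
  ultimately show ?thesis using isCont_cong[OF ev] by simp
qed (simp_all add: J_remainder_def)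

lemma J_remainder_tendsto:
  assumes "\<alpha> > 1" "\<theta> \<in> {0..pi}"
  shows "((\<lambda>\<beta>. (\<beta> - 1)\<^sup>2 * inverse (2 * \<beta> - 1) * inverse (2 * \<beta> - 3) * (sin \<theta>)\<^sup>2
      * relu_J (\<beta> - 2) \<theta>) \<longlongrightarrow> J_remainder \<alpha> \<theta>) (at \<alpha>)"
proof -
  have "((\<lambda>\<beta>. J_remainder \<beta> \<theta>) \<longlongrightarrow> J_remainder \<alpha> \<theta>) (at \<alpha>)"
    using isCont_J_remainder[OF assms] by (simp add: isCont_def)
  \<comment> \<open>The filter \<open>at \<alpha>\<close> omits \<alpha> itself, so \<beta> \<noteq>
    3/2 holds eventually also if \<alpha> = 3/2.\<close>
  moreover have "\<forall>\<^sub>F \<beta> in at \<alpha>. \<beta> > 1 \<and> \<beta> \<noteq> 3/2"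
    using assms(1) by (intro eventually_conj eventually_neq_at_within order_tendstoD[OF tendsto_ident_at])
  then have "\<forall>\<^sub>F \<beta> in at \<alpha>. J_remainder \<beta> \<theta> =
      (\<beta> - 1)\<^sup>2 * inverse (2 * \<beta> - 1) * inverse (2 * \<beta> - 3) * (sin \<theta>)\<^sup>2 * relu_J (\<beta> - 2) \<theta>"
    by eventually_elim (use assms(2) J_remainder_eq_relu_J in blast)
  ultimately show ?thesis by (rule Lim_transform_eventually)
qed

text \<open>At \<alpha> = 3/2 the coefficient has a pole and the kernel of index -1/2 is
  \<open>0\<close> in the interior, so the last summand is an indeterminate product; it is read as
  its limit in the index.\<close>

theorem lemmaC33:
  fixes \<alpha> :: real
  assumes "\<alpha> > 1"
  shows
    "(\<alpha> \<noteq> 3/2 \<longrightarrow>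
       (\<forall>\<theta>\<in>{0..pi}. relu_J \<alpha> \<theta> =
          cos \<theta> * relu_J (\<alpha> - 1) \<theta>
          + (\<alpha> - 1)^2 * inverse (2 * \<alpha> - 1) * inverse (2 * \<alpha> - 3) * (sin \<theta>)^2
            * relu_J (\<alpha> - 2) \<theta>) \<and>
       (\<forall>c\<in>{-1..1}. relu_JJ \<alpha> c =
          c * relu_JJ (\<alpha> - 1) c
          + (\<alpha> - 1)^2 * inverse (2 * \<alpha> - 1) * inverse (2 * \<alpha> - 3) * (1 - c^2)
            * relu_JJ (\<alpha> - 2) c)) \<and>
     (\<alpha> = 3/2 \<longrightarrow>
       (\<forall>\<theta>\<in>{0..pi}. \<exists>L.
          ((\<lambda>\<beta>. (\<beta> - 1)^2 * inverse (2 * \<beta> - 1) * inverse (2 * \<beta> - 3) * (sin \<theta>)^2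
                 * relu_J (\<beta> - 2) \<theta>) \<longlongrightarrow> L) (at \<alpha>) \<and>
          relu_J \<alpha> \<theta> = cos \<theta> * relu_J (\<alpha> - 1) \<theta> + L) \<and>
       (\<forall>c\<in>{-1..1}. \<exists>L.
          ((\<lambda>\<beta>. (\<beta> - 1)^2 * inverse (2 * \<beta> - 1) * inverse (2 * \<beta> - 3) * (1 - c^2)
                 * relu_JJ (\<beta> - 2) c) \<longlongrightarrow> L) (at \<alpha>) \<and>
          relu_JJ \<alpha> c = c * relu_JJ (\<alpha> - 1) c + L))"
proof -
  have angle: "arccos c \<in> {0..pi}" "cos (arccos c) = c" "(sin (arccos c))\<^sup>2 = 1 - c\<^sup>2"
    if "c \<in> {-1..1}" for c
    using that by (auto simp: arccos_lbound arccos_ubound sin_squared_eq)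
  note recurrence = relu_J_recurrence[OF assms] and remainder = J_remainder_eq_relu_J[OF assms]
    and limit = J_remainder_tendsto[OF assms]
  show ?thesis
  proof (intro conjI impI ballI)
    fix \<theta> :: real assume "\<alpha> \<noteq> 3/2" "\<theta> \<in> {0..pi}"
    then show "relu_J \<alpha> \<theta> = cos \<theta> * relu_J (\<alpha> - 1) \<theta>
        + (\<alpha> - 1)^2 * inverse (2 * \<alpha> - 1) * inverse (2 * \<alpha> - 3) * (sin \<theta>)^2 * relu_J (\<alpha> - 2) \<theta>"
      using recurrence remainder by simp
  next
    fix c :: real assume "\<alpha> \<noteq> 3/2" and c: "c \<in> {-1..1}"
    then show "relu_JJ \<alpha> c = c * relu_JJ (\<alpha> - 1) c
        + (\<alpha> - 1)^2 * inverse (2 * \<alpha> - 1) * inverse (2 * \<alpha> - 3) * (1 - c^2) * relu_JJ (\<alpha> - 2) c"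
      using recurrence[OF angle(1)[OF c]] remainder[OF _ angle(1)[OF c]] angle(2,3)[OF c]
      by (simp add: relu_JJ_def)
  next
    \<comment> \<open>The witness for \<open>L\<close> is
      \<open>J_remainder \<alpha> \<theta>\<close>, and below it is
      \<open>J_remainder \<alpha> (arccos c)\<close>.\<close>
    fix \<theta> :: real assume "\<theta> \<in> {0..pi}"
    then show "\<exists>L. ((\<lambda>\<beta>. (\<beta> - 1)^2 * inverse (2 * \<beta> - 1) * inverse (2 * \<beta> - 3) * (sin \<theta>)^2
            * relu_J (\<beta> - 2) \<theta>) \<longlongrightarrow> L) (at \<alpha>) \<and>
          relu_J \<alpha> \<theta> = cos \<theta> * relu_J (\<alpha> - 1) \<theta> + L"
      using recurrence limit by blast
  next
    fix c :: real assume c: "c \<in> {-1..1}"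
    show "\<exists>L. ((\<lambda>\<beta>. (\<beta> - 1)^2 * inverse (2 * \<beta> - 1) * inverse (2 * \<beta> - 3) * (1 - c^2)
            * relu_JJ (\<beta> - 2) c) \<longlongrightarrow> L) (at \<alpha>) \<and>
          relu_JJ \<alpha> c = c * relu_JJ (\<alpha> - 1) c + L"
      using recurrence[OF angle(1)[OF c]] limit[OF angle(1)[OF c]]
      unfolding relu_JJ_def angle(2,3)[OF c] by blast
  qed
qed

end
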